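(* Let $G$ be a one-step $W$-groupoid, i.e. a non-commutative idempotent right modular groupoid all of whose proper subgroupoids are commutative. Then $G$ is a quasigroup: for all $x,y\in G$ there exist a unique $t\in G$ and a unique $s\in G$ such that $xt=y$ and $sx=y$.
   Context: A groupoid is a set with a binary operation, written by juxtaposition; $xy\cdot z$ means $(xy)z$. $W$ is the variety of idempotent right modular groupoids, i.e. groupoids satisfying $xx=x$ and $(xy)z=(zy)x$ for all $x,y,z$. A one-step $W$-groupoid is a non-commutative groupoid $G\in W$ (finite or infinite) such that every proper subgroupoid of $G$ is commutative. *)

theory Defs
  imports Main
begin

text \<open>A groupoid (magma) is given by a carrier set \<open>G\<close> and an operation \<open>m\<close>; only the values of
  \<open>m\<close> on \<open>G\<close> matter.\<close>

definition groupoid_on :: "'a set \<Rightarrow> ('a \<Rightarrow> 'a \<Rightarrow> 'a) \<Rightarrow> bool" where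
  "groupoid_on G m \<longleftrightarrow> (\<forall>x\<in>G. \<forall>y\<in>G. m x y \<in> G)"

definition subgroupoid :: "'a set \<Rightarrow> 'a set \<Rightarrow> ('a \<Rightarrow> 'a \<Rightarrow> 'a) \<Rightarrow> bool" where
  "subgroupoid H G m \<longleftrightarrow> H \<subseteq> G \<and> groupoid_on H m"

definition commutative_on :: "'a set \<Rightarrow> ('a \<Rightarrow> 'a \<Rightarrow> 'a) \<Rightarrow> bool" where
  "commutative_on G m \<longleftrightarrow> (\<forall>x\<in>G. \<forall>y\<in>G. m x y = m y x)"

definition W_groupoid :: "'a set \<Rightarrow> ('a \<Rightarrow> 'a \<Rightarrow> 'a) \<Rightarrow> bool" where
  "W_groupoid G m \<longleftrightarrow>
     groupoid_on G m \<and>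
     (\<forall>x\<in>G. m x x = x) \<and>
     (\<forall>x\<in>G. \<forall>y\<in>G. \<forall>z\<in>G. m (m x y) z = m (m z y) x)"

definition one_step_W_groupoid :: "'a set \<Rightarrow> ('a \<Rightarrow> 'a \<Rightarrow> 'a) \<Rightarrow> bool" where
  "one_step_W_groupoid G m \<longleftrightarrow>
     W_groupoid G m \<and>
     \<not> commutative_on G m \<and>
     (\<forall>H. subgroupoid H G m \<and> H \<noteq> G \<longrightarrow> commutative_on H m)"

definition quasigroup_on :: "'a set \<Rightarrow> ('a \<Rightarrow> 'a \<Rightarrow> 'a) \<Rightarrow> bool" where
  "quasigroup_on G m \<longleftrightarrow>
     groupoid_on G m \<and>
     (\<forall>x\<in>G. \<forall>y\<in>G. (\<exists>!t. t \<in> G \<and> m x t = y) \<and> (\<exists>!s. s \<in> G \<and> m s x = y))"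

end

theory Submission
  imports Defs
begin

text \<open>
  Right modularity and idempotence make \<open>G\<close> medial, hence distributive, so every right translation
  \<open>R\<^sub>y x = xy\<close> is an endomorphism, and \<open>(xy)y = yx\<close> says that left translations are squares of right
  translations. It therefore suffices that each \<open>R\<^sub>y\<close> is bijective.

  If the image \<open>Gy\<close> is proper, it is commutative. For non-commuting \<open>a\<close>, \<open>b\<close> the \<open>R\<^sub>y\<close>-fibre of \<open>ab\<close>
  contains \<open>ba\<close>, and it cannot be commutative, as the identity \<open>x(ab) = (xa)(xb)\<close> for \<open>x = ab\<close> and
  its mirror image would then give \<open>ab = ba\<close>. So this fibre is all of \<open>G\<close> and \<open>y\<close> is a zero element.
  Then \<open>Gv = G\<close> for every nonzero \<open>v\<close>, which rules out zero divisors, because the annihilator of an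
  element is an ideal. Hence \<open>G - {y}\<close> is a proper non-commutative subgroupoid, a contradiction.

  If \<open>R\<^sub>y\<close> is not injective, then two points of some fibre, which is a proper and hence commutative
  subgroupoid, yield \<open>u \<noteq> v\<close> with \<open>uv = vu = v\<close>. Choosing \<open>p\<close> with \<open>pv = u\<close> gives
  \<open>vp = (pv)v = v\<close>, whence \<open>u = pv = (vp)p = vp = v\<close>.
\<close>

locale W_groupoid_loc =
  fixes G :: "'a set" and mult :: "'a \<Rightarrow> 'a \<Rightarrow> 'a" (infixl "\<cdot>" 70)
  assumes W: "W_groupoid G (\<cdot>)"
begin

lemma closed [simp, intro]: "x \<in> G \<Longrightarrow> y \<in> G \<Longrightarrow> x \<cdot> y \<in> G"
  using W by (simp add: W_groupoid_def groupoid_on_def)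

lemma idem [simp]: "x \<in> G \<Longrightarrow> x \<cdot> x = x"
  using W by (simp add: W_groupoid_def)

lemma right_modular: "x \<in> G \<Longrightarrow> y \<in> G \<Longrightarrow> z \<in> G \<Longrightarrow> x \<cdot> y \<cdot> z = z \<cdot> y \<cdot> x"
  using W by (simp add: W_groupoid_def)

lemma mult_right_twice: "x \<in> G \<Longrightarrow> y \<in> G \<Longrightarrow> x \<cdot> y \<cdot> y = y \<cdot> x"
  by (metis idem right_modular)

lemma medial:
  assumes "a \<in> G" "b \<in> G" "c \<in> G" "d \<in> G"
  shows "(a \<cdot> b) \<cdot> (c \<cdot> d) = (a \<cdot> c) \<cdot> (b \<cdot> d)"
proof -
  have "(a \<cdot> b) \<cdot> (c \<cdot> d) = c \<cdot> d \<cdot> b \<cdot> a"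
    using assms by (intro right_modular) auto
  also have "\<dots> = b \<cdot> d \<cdot> c \<cdot> a"
    using assms right_modular[of c d b] by simp
  also have "\<dots> = (a \<cdot> c) \<cdot> (b \<cdot> d)"
    using assms by (intro right_modular) auto
  finally show ?thesis .
qed

lemma left_distrib: "x \<in> G \<Longrightarrow> y \<in> G \<Longrightarrow> z \<in> G \<Longrightarrow> x \<cdot> (y \<cdot> z) = (x \<cdot> y) \<cdot> (x \<cdot> z)"
  using medial[of x x y z] by simp

lemma right_distrib: "x \<in> G \<Longrightarrow> y \<in> G \<Longrightarrow> z \<in> G \<Longrightarrow> (x \<cdot> y) \<cdot> z = (x \<cdot> z) \<cdot> (y \<cdot> z)"
  using medial[of x y z z] by simp

lemma subgroupoid_right_image:
  assumes "y \<in> G"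
  shows "subgroupoid ((\<lambda>x. x \<cdot> y) ` G) G (\<cdot>)"
  using assms by (auto simp: subgroupoid_def groupoid_on_def right_distrib[symmetric])

text \<open>Closure holds because right translation is an endomorphism and its value
  \<open>z\<close> is idempotent.\<close>

lemma subgroupoid_right_fibre:
  assumes "y \<in> G" "z \<in> G"
  shows "subgroupoid {x \<in> G. x \<cdot> y = z} G (\<cdot>)"
proof -
  have "u \<cdot> v \<cdot> y = z" if "u \<in> G" "v \<in> G" "u \<cdot> y = z" "v \<cdot> y = z" for u v
    using that assms right_distrib[of u v y] by simp
  then show ?thesis by (auto simp: subgroupoid_def groupoid_on_def)
qed

lemma commuting_absorb:
  assumes "x \<in> G" "y \<in> G" "x \<cdot> y = y \<cdot> x"
  shows "x \<cdot> y \<cdot> x = x \<cdot> y"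
  using assms mult_right_twice[of y x] by simp

lemma commuting_absorb_left:
  assumes "x \<in> G" "y \<in> G" "x \<cdot> y = y \<cdot> x"
  shows "x \<cdot> (x \<cdot> y) = x \<cdot> y"
  using assms commuting_absorb mult_right_twice[of "x \<cdot> y" x] by simp

lemma quasigroup_if_right_translations_bij:
  assumes bij: "\<And>y. y \<in> G \<Longrightarrow> bij_betw (\<lambda>x. x \<cdot> y) G G"
  shows "quasigroup_on G (\<cdot>)"
proof -
  have right: "\<exists>!s. s \<in> G \<and> s \<cdot> x = y" if "x \<in> G" "y \<in> G" for x y
  proof -
    have "y \<in> (\<lambda>s. s \<cdot> x) ` G"
      using bij_betw_imp_surj_on[OF bij[OF that(1)]] that(2) by simp
    then obtain s where s: "s \<in> G" "s \<cdot> x = y" by blast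
    have "s' = s" if "s' \<in> G" "s' \<cdot> x = y" for s'
      by (rule inj_onD[OF bij_betw_imp_inj_on[OF bij[OF \<open>x \<in> G\<close>]]]) (use s that in auto)
    then show ?thesis using s by blast
  qed
  have left: "\<exists>!t. t \<in> G \<and> x \<cdot> t = y" if xy: "x \<in> G" "y \<in> G" for x y
  proof -
    \<comment> \<open>Since \<open>x \<cdot> t = t \<cdot> x \<cdot> x\<close>, solving for
      \<open>t\<close> means dividing by \<open>x\<close> on the right twice.\<close>
    obtain s where s: "s \<in> G" "s \<cdot> x = y" using right[OF xy] by blast
    obtain t where t: "t \<in> G" "t \<cdot> x = s" using right[OF xy(1) s(1)] by blast
    show ?thesis
    proof (rule ex1I[of _ t])
      show "t \<in> G \<and> x \<cdot> t = y"
        using s t xy mult_right_twice[of t x] by simp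
    next
      fix t' assume t': "t' \<in> G \<and> x \<cdot> t' = y"
      then have "t' \<cdot> x \<cdot> x = y" using xy mult_right_twice by simp
      then have "t' \<cdot> x = s" using right[OF xy] s t' xy by blast
      then show "t' = t" using right[OF xy(1) s(1)] t t' by blast
    qed
  qed
  show ?thesis
    using left right by (simp add: quasigroup_on_def groupoid_on_def)
qed

end

locale one_step_W_groupoid_loc = W_groupoid_loc +
  assumes noncommutative: "\<not> commutative_on G (\<cdot>)"
    and proper_commutative: "\<And>H. subgroupoid H G (\<cdot>) \<Longrightarrow> H \<noteq> G \<Longrightarrow> commutative_on H (\<cdot>)"
begin

lemma right_translation_surj_or_const:
  assumes y: "y \<in> G"
  shows "(\<lambda>x. x \<cdot> y) ` G = G \<or> (\<forall>x\<in>G. x \<cdot> y = y)"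
proof (unfold disj_imp, intro impI)
  assume "(\<lambda>x. x \<cdot> y) ` G \<noteq> G"
  then have "commutative_on ((\<lambda>x. x \<cdot> y) ` G) (\<cdot>)"
    using proper_commutative subgroupoid_right_image y by blast
  then have comm: "(x \<cdot> y) \<cdot> (z \<cdot> y) = (z \<cdot> y) \<cdot> (x \<cdot> y)" if "x \<in> G" "z \<in> G" for x z
    using that by (simp add: commutative_on_def)
  obtain a b where ab: "a \<in> G" "b \<in> G" "a \<cdot> b \<noteq> b \<cdot> a"
    using noncommutative by (auto simp: commutative_on_def)
  define H where "H = {x \<in> G. x \<cdot> y = a \<cdot> b \<cdot> y}"
  have sub: "subgroupoid H G (\<cdot>)"
    unfolding H_def using ab y by (intro subgroupoid_right_fibre) auto
  have ba_y: "b \<cdot> a \<cdot> y = a \<cdot> b \<cdot> y"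
    using ab y comm right_distrib[of a b y] right_distrib[of b a y] by simp
  \<comment> \<open>\<open>a \<cdot> y\<close> and \<open>b \<cdot> y\<close> commute in the image,
    so absorption there shows that these products share one fibre.\<close>
  have "a \<cdot> b \<cdot> a \<cdot> y = a \<cdot> b \<cdot> y"
    using commuting_absorb[OF _ _ comm[OF ab(1,2)]] ab y
      right_distrib[of "a \<cdot> b" a y] right_distrib[of a b y] by simp
  moreover have "b \<cdot> a \<cdot> b \<cdot> y = b \<cdot> a \<cdot> y"
    using commuting_absorb[OF _ _ comm[OF ab(2,1)]] ab y
      right_distrib[of "b \<cdot> a" b y] right_distrib[of b a y] by simp
  ultimately have in_H: "a \<cdot> b \<in> H" "b \<cdot> a \<in> H" "a \<cdot> b \<cdot> a \<in> H" "b \<cdot> a \<cdot> b \<in> H"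
    using ab ba_y by (auto simp: H_def)
  have "H = G"
  proof (rule ccontr)
    assume "H \<noteq> G"
    then have H_comm: "u \<cdot> v = v \<cdot> u" if "u \<in> H" "v \<in> H" for u v
      using that proper_commutative[OF sub] by (simp add: commutative_on_def)
    have below: "p \<cdot> q \<cdot> (q \<cdot> p) = p \<cdot> q"
      if "p \<in> G" "q \<in> G" "p \<cdot> q \<cdot> p \<in> H" "q \<cdot> p \<in> H" for p q
    proof -
      \<comment> \<open>Distribute \<open>p \<cdot> q\<close> over the product
        \<open>p \<cdot> q\<close> in its own square.\<close>
      have eq: "p \<cdot> q = p \<cdot> q \<cdot> p \<cdot> (q \<cdot> p)"
        using that left_distrib[of "p \<cdot> q" p q] mult_right_twice[of p q] by simp
      have "p \<cdot> q \<cdot> p \<cdot> (q \<cdot> p) \<cdot> (q \<cdot> p) = q \<cdot> p \<cdot> (p \<cdot> q \<cdot> p)"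
        using that by (intro mult_right_twice) auto
      also have "\<dots> = p \<cdot> q \<cdot> p \<cdot> (q \<cdot> p)"
        using that by (intro H_comm)
      finally show ?thesis using eq by simp
    qed
    have "a \<cdot> b = a \<cdot> b \<cdot> (b \<cdot> a)"
      using below[of a b] ab in_H by simp
    also have "\<dots> = b \<cdot> a \<cdot> (a \<cdot> b)"
      using H_comm in_H by blast
    also have "\<dots> = b \<cdot> a"
      using below[of b a] ab in_H by simp
    finally show False using ab by simp
  qed
  show "\<forall>x\<in>G. x \<cdot> y = y"
  proof (intro ballI)
    fix x assume "x \<in> G"
    \<comment> \<open>With \<open>y\<close> itself in the fibre, the constant value is
      \<open>y \<cdot> y = y\<close>.\<close>
    then have "x \<in> H" "y \<in> H" using \<open>H = G\<close> y by auto
    then show "x \<cdot> y = y" using y by (simp add: H_def)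
  qed
qed

lemma right_translation_surj:
  assumes z: "z \<in> G"
  shows "(\<lambda>x. x \<cdot> z) ` G = G"
proof (rule ccontr)
  assume "(\<lambda>x. x \<cdot> z) ` G \<noteq> G"
  then have right_zero: "x \<cdot> z = z" if "x \<in> G" for x
    using that right_translation_surj_or_const[OF z] by blast
  have left_zero: "z \<cdot> x = z" if "x \<in> G" for x
    using that z right_zero mult_right_twice[of x z] by simp
  \<comment> \<open>A constant translation would give \<open>v = z \<cdot> v = z\<close>.\<close>
  have surj: "(\<lambda>x. x \<cdot> v) ` G = G" if v: "v \<in> G" "v \<noteq> z" for v
    using right_translation_surj_or_const[OF v(1)] left_zero[OF v(1)] z v by metis
  have no_zero_divisors: "u \<cdot> v \<noteq> z" if uv: "u \<in> G" "v \<in> G" "u \<noteq> z" "v \<noteq> z" for u v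
  proof
    assume "u \<cdot> v = z"
    obtain w where w: "w \<in> G" "w \<cdot> v = u"
      using surj[OF uv(2,4)] uv(1) by (metis imageE)
    have "u = u \<cdot> (w \<cdot> v)" using w uv by simp
    also have "\<dots> = (u \<cdot> w) \<cdot> (u \<cdot> v)" using w uv by (intro left_distrib)
    also have "\<dots> = z" using \<open>u \<cdot> v = z\<close> w uv right_zero by simp
    finally show False using uv by simp
  qed
  have "subgroupoid (G - {z}) G (\<cdot>)"
    using no_zero_divisors by (auto simp: subgroupoid_def groupoid_on_def)
  then have "commutative_on (G - {z}) (\<cdot>)"
    using z by (intro proper_commutative) auto
  then have "x \<cdot> y = y \<cdot> x" if "x \<in> G" "y \<in> G" for x y
    using that left_zero right_zero
    by (cases "x = z \<or> y = z") (auto simp: commutative_on_def)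
  then have "commutative_on G (\<cdot>)" by (simp add: commutative_on_def)
  then show False using noncommutative by simp
qed

text \<open>Surjectivity yields cancellation here: the lemma collapses the semilattice order on a
  commuting pair, which is what injectivity needs.\<close>

lemma left_absorbed_imp_eq:
  assumes uv: "u \<in> G" "v \<in> G" "u \<cdot> v = v"
  shows "u = v"
proof -
  obtain p where p: "p \<in> G" "p \<cdot> v = u"
    using right_translation_surj[OF uv(2)] uv(1) by (metis imageE)
  have "v \<cdot> p = v"
    using mult_right_twice[OF p(1) uv(2)] p uv by simp
  then show ?thesis
    using mult_right_twice[OF uv(2) p(1)] p by simp
qed

lemma right_translation_inj:
  assumes y: "y \<in> G"
  shows "inj_on (\<lambda>x. x \<cdot> y) G"
proof (rule inj_onI)
  fix u v assume uv: "u \<in> G" "v \<in> G" "u \<cdot> y = v \<cdot> y"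
  define H where "H = {x \<in> G. x \<cdot> y = v \<cdot> y}"
  have sub: "subgroupoid H G (\<cdot>)"
    unfolding H_def using uv y by (intro subgroupoid_right_fibre) auto
  \<comment> \<open>Otherwise the translation is both constant and onto, leaving at most one point
    in \<open>G\<close>.\<close>
  have "H \<noteq> G"
  proof
    assume "H = G"
    then have "(\<lambda>x. x \<cdot> y) ` G \<subseteq> {v \<cdot> y}" by (auto simp: H_def)
    then have "G \<subseteq> {v \<cdot> y}" using right_translation_surj[OF y] by simp
    then have "commutative_on G (\<cdot>)" by (auto simp: commutative_on_def)
    then show False using noncommutative by simp
  qed
  then have "commutative_on H (\<cdot>)" using proper_commutative sub by blast
  moreover have "u \<in> H" "v \<in> H" using uv by (auto simp: H_def)
  ultimately have comm: "u \<cdot> v = v \<cdot> u" by (simp add: commutative_on_def)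
  \<comment> \<open>For commuting \<open>u\<close> and \<open>v\<close>, the product
    \<open>u \<cdot> v\<close> is absorbed by \<open>u\<close> from the left, and likewise by
    \<open>v\<close>.\<close>
  have "u = u \<cdot> v"
    using left_absorbed_imp_eq[OF uv(1) _ commuting_absorb_left[OF uv(1,2) comm]] uv by simp
  moreover have "v = v \<cdot> u"
    using left_absorbed_imp_eq[OF uv(2) _ commuting_absorb_left[OF uv(2,1) comm[symmetric]]] uv
    by simp
  ultimately show "u = v" using comm by simp
qed

lemma quasigroup: "quasigroup_on G (\<cdot>)"
  by (rule quasigroup_if_right_translations_bij)
    (simp add: bij_betw_def right_translation_inj right_translation_surj)

end

theorem corollary9:
  fixes G :: "'a set" and m :: "'a \<Rightarrow> 'a \<Rightarrow> 'a"
  assumes "one_step_W_groupoid G m"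
  shows "quasigroup_on G m"
proof -
  interpret one_step_W_groupoid_loc G m
    using assms by unfold_locales (auto simp: one_step_W_groupoid_def)
  show ?thesis by (rule quasigroup)
qed

end
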